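(* Fix a beam $k\in\{1,\dots,K\}$ with $K\ge2$ and a user $n\in\{1,\dots,N\}$ of that beam. Let $Z=Z_n^{(k)}$ be a shadowed-Rician power gain with parameters $(m,b,\Omega)=(m_n^{(k)},b_n^{(k)},\Omega_n^{(k)})$, $m$ a positive integer, with associated constants $\alpha,\beta,\delta$. For each $\ell\ne k$ let $Z^{(\ell)}$ be a shadowed-Rician power gain with parameters $(m^{(\ell)},b^{(\ell)},\Omega^{(\ell)})$, $m^{(\ell)}$ a positive integer, all of these gains (including $Z$) being independent, and let the aggregate inter-beam interference power be $$I=\sum_{\ell\ne k}P^{(\ell)}L^{(\ell)}Z^{(\ell)},\qquad P^{(\ell)},L^{(\ell)}>0.$$ Let $P=P^{(k)}>0$, $L=L_n^{(k)}>0$, $N_0>0$, let $\zeta_c,\zeta_1,\dots,\zeta_N\ge0$ satisfy $\zeta_c+\sum_{j=1}^N\zeta_j=1$, and let $\gamma_c^{th}=2^{R_c}-1$, $\gamma_p^{th}=2^{R_p}-1$ with target rates $R_c,R_p>0$. Define $$\Upsilon_{c,n}=\frac{P\zeta_c ZL}{P(1-\zeta_c)ZL+I+N_0},\qquad \Upsilon_{p,n}=\frac{P\zeta_n ZL}{\sum_{j\ne n}P\zeta_j ZL+I+N_0}.$$ Let $\hat P_{\mathrm{out},n}$ be the outage probability of the user, i.e. the probability that $\Upsilon_{c,n}<\gamma_c^{th}$ or $\Upsilon_{p,n}<\gamma_p^{th}$, and let $\hat{\mathcal P}_c=\Pr(\Upsilon_{c,n}<\gamma_c^{th})$, $\hat{\mathcal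 P}_p=\Pr(\Upsilon_{p,n}<\gamma_p^{th})$. Set $$\mu_I=\sum_{\ell\neq k}P^{(\ell)}L^{(\ell)}\left(\Omega^{(\ell)}+2b^{(\ell)}\right),\qquad \sigma_I^2=\sum_{\ell\neq k}\left(P^{(\ell)}L^{(\ell)}\right)^2\left(4(b^{(\ell)})^2+4b^{(\ell)}\Omega^{(\ell)}+\frac{(\Omega^{(\ell)})^2}{m^{(\ell)}}\right),$$ $$\kappa=\frac{\mu_I^2}{\sigma_I^2},\qquad \Theta=\frac{\sigma_I^2}{\mu_I},\qquad A_1=\beta-\delta,$$ $$\tilde A_2=PL\left(\zeta_c-\gamma_c^{th}(1-\zeta_c)\right),\qquad \tilde A_3=PL\Big(\zeta_n-\gamma_p^{th}\sum_{j\ne n}\zeta_j\Big),$$ and, where the denominators are positive, $t_c=\gamma_c^{th}/\tilde A_2$, $t_p=\gamma_p^{th}/\tilde A_3$, $V_1=A_1t_c$, $V_2=A_1t_p$. Then $$\hat P_{\mathrm{out},n}=\max\left(\hat{\mathcal P}_c,\hat{\mathcal P}_p\right),$$ where, under the approximation of $I$ by a Gamma random variable with shape $\kappa$ and scale $\Theta$ (matching the mean $\mu_I$ and variance $\sigma_I^2$ of $I$), if $\tilde A_2>0$, $$\hat{\mathcal P}_c\approx1-\sum_{i=0}^{m-1}\sum_{l=0}^{i}\sum_{q=0}^{l}\binom{m-1}{i}\binom{l}{q}\,\alpha\,\delta^{i}\,e^{-V_1N_0}\,\frac{t_c^{\,l}}{l!\,A_1^{\,i-l+1}}\,N_0^{\,l-q}\,\Theta^{q}\,(\kappa)_q\,(1+\Theta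 V_1)^{-(\kappa+q)},$$ and, if $\tilde A_3>0$, $$\hat{\mathcal P}_p\approx1-\sum_{i=0}^{m-1}\sum_{l=0}^{i}\sum_{q=0}^{l}\binom{m-1}{i}\binom{l}{q}\,\alpha\,\delta^{i}\,e^{-V_2N_0}\,\frac{t_p^{\,l}}{l!\,A_1^{\,i-l+1}}\,N_0^{\,l-q}\,\Theta^{q}\,(\kappa)_q\,(1+\Theta V_2)^{-(\kappa+q)};$$ otherwise (if $\tilde A_2\le0$, respectively $\tilde A_3\le0$) the corresponding outage probability $\hat{\mathcal P}_c$, respectively $\hat{\mathcal P}_p$, equals $1$.
   Context: Shadowed-Rician power gain: for a positive integer $m$ and reals $b,\Omega>0$, a nonnegative random variable $Z$ is a shadowed-Rician power gain with parameters $(m,b,\Omega)$ if it has density $$f_Z(z)=\alpha e^{-\beta z}\,{}_1F_1(m;1;\delta z),\quad z\ge0,$$ where ${}_1F_1$ is the confluent hypergeometric function of the first kind and $$\alpha=\frac1{2b}\left(\frac{2bm}{2bm+\Omega}\right)^m,\quad \beta=\frac1{2b},\quad \delta=\frac{\Omega}{2b(2bm+\Omega)}.$$ The rising factorial is $(x)_q=x(x+1)\cdots(x+q-1)$, with $(x)_0=1$. The Gamma distribution with shape $\kappa$ and scale $\Theta$ has density $x^{\kappa-1}e^{-x/\Theta}/(\Gamma(\kappa)\Theta^\kappa)$ on $x>0$. Setting: downlink rate-splitting multiple access from a high-altitude platform with full frequency reuse across $K$ beams. $P^{(\ell)}$ is the transmit power of beam $\ell$, $L^{(\ell)}$ the deterministic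 large-scale gain from beam $\ell$ to the user, $N_0$ the noise power, $\zeta_c$ the power fraction of the common stream and $\zeta_j$ that of user $j$'s private stream (in beam $k$). $\Upsilon_{c,n}$ and $\Upsilon_{p,n}$ are the signal-to-interference-plus-noise ratios of the user for the common stream and for its private stream after cancellation of the common stream. The symbol $\approx$ carries no error bound: the actual interference $I$ is a sum of independent scaled shadowed-Rician power gains, and the right-hand sides are obtained by replacing the law of $I$ by the moment-matched Gamma law when averaging the distribution function of $Z$, evaluated at $t_c(I+N_0)$ or $t_p(I+N_0)$, over $I$. *)

theory Defs
  imports "HOL-Probability.Probability"
begin

definition hyp_1F1 :: "real \<Rightarrow> real \<Rightarrow> real \<Rightarrow> real" where
  "hyp_1F1 a c z = eval_fps (fps_hypergeo [a] [c] 1) z"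

definition sr_alpha :: "nat \<Rightarrow> real \<Rightarrow> real \<Rightarrow> real" where
  "sr_alpha m b \<Omega> = 1 / (2 * b) * (2 * b * real m / (2 * b * real m + \<Omega>)) ^ m"

definition sr_beta :: "real \<Rightarrow> real" where
  "sr_beta b = 1 / (2 * b)"

definition sr_delta :: "nat \<Rightarrow> real \<Rightarrow> real \<Rightarrow> real" where
  "sr_delta m b \<Omega> = \<Omega> / (2 * b * (2 * b * real m + \<Omega>))"

definition sr_density :: "nat \<Rightarrow> real \<Rightarrow> real \<Rightarrow> real \<Rightarrow> real" where
  "sr_density m b \<Omega> z =
     (if 0 \<le> z
      then sr_alpha m b \<Omega> * exp (- sr_beta b * z) * hyp_1F1 (real m) 1 (sr_delta m b \<Omega> * z)
      else 0)"

(* Nonnegativity of Z holds almost surely, as the density vanishes on the negative half-line. *)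
definition sr_power_gain ::
    "'a measure \<Rightarrow> ('a \<Rightarrow> real) \<Rightarrow> nat \<Rightarrow> real \<Rightarrow> real \<Rightarrow> bool" where
  "sr_power_gain M Z m b \<Omega> \<longleftrightarrow>
     0 < m \<and> 0 < b \<and> 0 < \<Omega> \<and> distributed M lborel Z (\<lambda>z. ennreal (sr_density m b \<Omega> z))"

definition gamma_density :: "real \<Rightarrow> real \<Rightarrow> real \<Rightarrow> real" where
  "gamma_density \<kappa> \<Theta> x =
     (if 0 < x then x powr (\<kappa> - 1) * exp (- x / \<Theta>) / (Gamma \<kappa> * \<Theta> powr \<kappa>) else 0)"

definition gamma_law :: "real \<Rightarrow> real \<Rightarrow> real measure" where
  "gamma_law \<kappa> \<Theta> = density lborel (\<lambda>x. ennreal (gamma_density \<kappa> \<Theta> x))"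

(* The distribution function of the gain law \<nu>Z, evaluated at t * (x + N0) and averaged over an
   interference power x with law \<nu>I.  The true law of the interference gives the exact outage
   probability; its Gamma surrogate gives the approximation. *)
definition outage_average :: "real measure \<Rightarrow> real \<Rightarrow> real \<Rightarrow> real measure \<Rightarrow> real" where
  "outage_average \<nu>Z t N0 \<nu>I = (\<integral>x. cdf \<nu>Z (t * (x + N0)) \<partial>\<nu>I)"

end

(* By Kummer's transformation 1F1(m;1;x) = exp x * (SUM i<m. C(m-1,i) x^i / i!), the shadowed-Rician
   density is a binomial mixture of Erlang densities with common rate A1 = beta - delta and success
   probability Omega / (2bm + Omega). Its moments and distribution function therefore reduce to
   binomial and Erlang ones, and averaging the latter over a Gamma law reduces to the integrals of
   x^q exp(-V x). For the outage events, clearing denominators turns each SINR condition into a bound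
   on Z by a multiple of I + N0 > 0, so the two events are nested almost surely. *)
theory Submission
  imports Defs
begin

text \<open>Integrality of \<open>m\<close> is what makes the Kummer sum finite. With
  \<open>d = m - 1\<close>, the rising factorial in the n-th hypergeometric coefficient is n! times
  the binomial C(n+d,d), and Vandermonde's identity expands this in the C(n,i) with i \<le> d, whose
  exponential generating functions are x^i / i! times exp x. The mixture weights are written as
  \<open>Bernstein\<close> polynomials because the total mass and the first two factorial moments of
  a binomial law are then the Bernstein sums known from Weierstrass approximation. Integrals are
  carried as \<open>has_bochner_integral\<close>, which gives integrability and value together, and
  second moments as mean squared plus variance, a shape that survives independent sums. The nesting
  of the two events cannot be read off from \<open>tc\<close> and \<open>tp\<close>, which are
  meaningful only for positive \<open>A2\<close> and \<open>A3\<close>. The ratios A2 / \<gamma>c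
  and A3 / \<gamma>p are compared instead: they are ordered whatever their signs.\<close>

section \<open>Kummer's transformation for a positive integer first parameter\<close>

lemma binomial_exp_sums:
  fixes x :: real
  shows "(\<lambda>n. real (n choose i) * x ^ n / fact n) sums (x ^ i / fact i * exp x)"
proof -
  let ?f = "\<lambda>n. real (n choose i) * x ^ n / fact n"
  have "(\<lambda>n. x ^ n / fact n) sums exp x"
    using exp_converges[of x] by (simp add: field_simps)
  then have "(\<lambda>n. x ^ i / fact i * (x ^ n / fact n)) sums (x ^ i / fact i * exp x)"
    by (rule sums_mult)
  \<comment> \<open>Since C(n+i,i) / (n+i)! = 1 / (i! n!), the series is the exponential series
    moved up by i places; the terms below i vanish with the binomial.\<close>
  moreover have "x ^ i / fact i * (x ^ n / fact n) = ?f (n + i)" for n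
    by (simp add: binomial_fact power_add)
  ultimately have "(\<lambda>n. ?f (n + i)) sums (x ^ i / fact i * exp x)"
    by simp
  then have "?f sums (x ^ i / fact i * exp x + (\<Sum>n<i. ?f n))"
    using sums_iff_shift[of ?f i] by blast
  moreover have "(\<Sum>n<i. ?f n) = 0"
    by (intro sum.neutral) (simp add: binomial_eq_0)
  ultimately show ?thesis by (simp only: add_0_right)
qed

text \<open>The product (d+1)...(d+n) is (n+d)! / d!, that is n! C(n+d,d). Vandermonde then
  separates n from d, so that the only dependence on n is through C(n,i), as
  \<open>binomial_exp_sums\<close> requires.\<close>

lemma pochhammer_Suc_eq_binomial_sum:
  "pochhammer (real (Suc d)) n = fact n * (\<Sum>i\<le>d. real (d choose i) * real (n choose i))"
proof -
  have "pochhammer (real (Suc d)) n = fact n * real ((n + d) choose d)"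
  proof -
    have "fact (n + d) = fact d * pochhammer (real (Suc d)) n"
      using pochhammer_product'[of "1 :: real" d n] by (simp add: pochhammer_fact add.commute)
    then show ?thesis by (simp add: binomial_fact)
  qed
  also have "(n + d) choose d = (\<Sum>i\<le>d. (n choose i) * (d choose (d - i)))"
    by (rule vandermonde[symmetric])
  also have "\<dots> = (\<Sum>i\<le>d. (d choose i) * (n choose i))"
    by (intro sum.cong) (simp_all add: binomial_symmetric[symmetric])
  finally show ?thesis by simp
qed

lemma hyp_1F1_Suc_1:
  "hyp_1F1 (real (Suc d)) 1 x = exp x * (\<Sum>i\<le>d. real (d choose i) * x ^ i / fact i)"
proof -
  have "(\<lambda>n. \<Sum>i\<le>d. real (d choose i) * (real (n choose i) * x ^ n / fact n))
          sums (\<Sum>i\<le>d. real (d choose i) * (x ^ i / fact i * exp x))"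
    by (intro sums_sum sums_mult binomial_exp_sums)
  \<comment> \<open>The hypergeometric coefficient has n! twice in its denominator, once as
    \<open>pochhammer 1 n\<close>. One cancels against the n! of the rising factorial, the other
    remains as the exponential denominator.\<close>
  moreover have "(\<Sum>i\<le>d. real (d choose i) * (real (n choose i) * x ^ n / fact n))
      = fps_nth (fps_hypergeo [real (Suc d)] [1] 1) n * x ^ n" for n
    unfolding fps_hypergeo_nth
    by (simp only: foldl.simps pochhammer_Suc_eq_binomial_sum)
       (simp add: pochhammer_fact[symmetric] sum_distrib_right sum_divide_distrib mult.assoc)
  ultimately show ?thesis
    by (simp add: hyp_1F1_def eval_fps_def sums_iff sum_distrib_left mult_ac)
qed

section \<open>The gain density as a binomial mixture of Erlang densities\<close>

lemma sr_rate_eq: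
  assumes "0 < m" "0 < b" "0 < \<Omega>"
  shows "sr_beta b - sr_delta m b \<Omega> = real m / (2 * b * real m + \<Omega>)"
proof -
  define D where "D = 2 * b * real m + \<Omega>"
  have "D > 0" using assms by (simp add: D_def add_pos_pos)
  then have "1 / (2 * b) - \<Omega> / (2 * b * D) = (D - \<Omega>) / (2 * b * D)"
    using assms by (simp add: field_simps)
  also have "\<dots> = real m / D" using assms by (simp add: D_def)
  finally show ?thesis by (simp add: sr_beta_def sr_delta_def D_def)
qed

text \<open>Put p = \<Omega> / (2bm + \<Omega>) and let A be the rate. Then \<alpha> = (1-p)^m /
  (2b), \<delta> / A = p / (1-p) and 1 / (2bA) = 1 / (1-p), so \<alpha> \<delta>^i / A^(i+1)
  collapses to p^i (1-p)^(m-1-i).\<close>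

lemma Bernstein_sr:
  assumes "0 < m" "0 < b" "0 < \<Omega>" "i \<le> m - 1"
  shows "Bernstein (m - 1) i (\<Omega> / (2 * b * real m + \<Omega>))
    = real ((m - 1) choose i) * sr_alpha m b \<Omega> * sr_delta m b \<Omega> ^ i
        / (sr_beta b - sr_delta m b \<Omega>) ^ Suc i"
proof -
  define D where "D = 2 * b * real m + \<Omega>"
  have D: "D > 0" using assms by (simp add: D_def add_pos_pos)
  define d where "d = m - 1 - i"
  have m: "m = Suc (d + i)" using assms by (simp add: d_def)
  have 1: "1 - \<Omega> / D = 2 * b * real m / D" using D by (simp add: field_simps) (simp add: D_def)
  \<comment> \<open>The number \<open>m\<close> occurs both as an exponent and as a factor. The
    factor is generalised to \<open>x\<close>, so that splitting \<open>m\<close> into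
    \<open>Suc (d + i)\<close> affects exponents only.\<close>
  have "(\<Omega> / D) ^ i * (2 * b * x / D) ^ d
      = 1 / (2 * b) * (2 * b * x / D) ^ m * (\<Omega> / (2 * b * D)) ^ i / (x / D) ^ Suc i"
    if "x > 0" for x
    using that D assms(1-3)
    by (simp add: m power_divide power_mult_distrib power_add field_simps)
  from this[of "real m"] show ?thesis
    unfolding sr_rate_eq[OF assms(1-3)]
    unfolding Bernstein_def sr_alpha_def sr_delta_def D_def[symmetric] 1 d_def[symmetric]
    using assms(1) by (simp only: mult.assoc times_divide_eq_right of_nat_0_less_iff simp_thms)
qed

text \<open>The exponential produced by Kummer's transformation merges with exp(-\<beta> z) into
  exp(-A z). What remains is a polynomial, and each of its monomials is an Erlang density up to the
  factor 1 / A^(i+1) that \<open>Bernstein_sr\<close> absorbs.\<close>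

lemma sr_density_eq_erlang_mixture:
  assumes "0 < m" "0 < b" "0 < \<Omega>"
  shows "sr_density m b \<Omega> z
    = (\<Sum>i\<le>m - 1. Bernstein (m - 1) i (\<Omega> / (2 * b * real m + \<Omega>))
          * erlang_density i (sr_beta b - sr_delta m b \<Omega>) z)"
proof (cases "0 \<le> z")
  case True
  define A where "A = sr_beta b - sr_delta m b \<Omega>"
  have A: "A > 0" using assms by (simp add: A_def sr_rate_eq add_pos_pos)
  have m: "hyp_1F1 (real m) 1 x = exp x * (\<Sum>i\<le>m-1. real ((m-1) choose i) * x ^ i / fact i)" for x
    using hyp_1F1_Suc_1[of "m - 1"] assms by simp
  have e: "exp (- sr_beta b * z) * exp (sr_delta m b \<Omega> * z) = exp (- A * z)"
    by (simp add: A_def exp_add[symmetric] algebra_simps)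
  have "sr_density m b \<Omega> z = sr_alpha m b \<Omega> * (exp (- sr_beta b * z) * exp (sr_delta m b \<Omega> * z))
      * (\<Sum>i\<le>m-1. real ((m-1) choose i) * (sr_delta m b \<Omega> * z) ^ i / fact i)"
    using True by (simp add: sr_density_def m)
  also have "\<dots> = (\<Sum>i\<le>m - 1. real ((m - 1) choose i) * sr_alpha m b \<Omega> * sr_delta m b \<Omega> ^ i / A ^ Suc i
          * erlang_density i A z)"
    unfolding e sum_distrib_left
    using True A by (intro sum.cong) (simp_all add: erlang_density_def power_mult_distrib)
  also have "\<dots> = (\<Sum>i\<le>m - 1. Bernstein (m - 1) i (\<Omega> / (2 * b * real m + \<Omega>)) * erlang_density i A z)"
    using Bernstein_sr[OF assms] by (intro sum.cong) (simp_all add: A_def)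
  finally show ?thesis by (simp add: A_def)
next
  case False
  then show ?thesis by (simp add: sr_density_def erlang_density_def)
qed

lemma sr_density_nonneg:
  assumes "0 < m" "0 < b" "0 < \<Omega>"
  shows "0 \<le> sr_density m b \<Omega> z"
proof -
  have *: "0 < 2 * b * real m + \<Omega>" using assms by (simp add: add_pos_pos)
  have "0 \<le> \<Omega> / (2 * b * real m + \<Omega>)" "\<Omega> / (2 * b * real m + \<Omega>) \<le> 1"
    "0 \<le> sr_beta b - sr_delta m b \<Omega>"
    using assms * by (simp_all add: sr_rate_eq)
  then show ?thesis
    unfolding sr_density_eq_erlang_mixture[OF assms]
    by (intro sum_nonneg mult_nonneg_nonneg Bernstein_nonneg erlang_density_nonneg)
qed

section \<open>Moments and distribution function of the gain\<close>

text \<open>Reduces any expectation of the gain to Erlang integrals; it is applied to powers for the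
  moments and to the indicator of a half-line for the distribution function.\<close>

lemma has_bochner_integral_sr_power_gain:
  assumes Z: "sr_power_gain M Z m b \<Omega>"
    and g[measurable]: "g \<in> borel_measurable borel"
    and c: "\<And>i. has_bochner_integral lborel
              (\<lambda>z. erlang_density i (sr_beta b - sr_delta m b \<Omega>) z * g z) (c i)"
  shows "has_bochner_integral M (\<lambda>\<omega>. g (Z \<omega>))
           (\<Sum>i\<le>m - 1. Bernstein (m - 1) i (\<Omega> / (2 * b * real m + \<Omega>)) * c i)"
proof -
  have pos: "0 < m" "0 < b" "0 < \<Omega>" and D: "distributed M lborel Z (\<lambda>z. ennreal (sr_density m b \<Omega> z))"
    using Z by (auto simp: sr_power_gain_def)
  have "has_bochner_integral lborel (\<lambda>z. sr_density m b \<Omega> z * g z)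
     (\<Sum>i\<le>m - 1. Bernstein (m - 1) i (\<Omega> / (2 * b * real m + \<Omega>)) * c i)"
    unfolding sr_density_eq_erlang_mixture[OF pos] sum_distrib_right mult.assoc
    by (intro has_bochner_integral_sum has_bochner_integral_mult_right c)
  then show ?thesis
    using distributed_integrable[OF D, of g] distributed_integral[OF D, of g] sr_density_nonneg[OF pos]
    by (simp add: has_bochner_integral_iff)
qed

lemma has_bochner_integral_erlang_moment:
  assumes "0 < l"
  shows "has_bochner_integral lborel (\<lambda>z. erlang_density k l z * z ^ j) (fact (k + j) / (fact k * l ^ j))"
proof (rule has_bochner_integral_nn_integral)
  show "AE z in lborel. 0 \<le> erlang_density k l z * z ^ j"
    using assms by (auto simp: erlang_density_def)
qed (use assms nn_integral_erlang_ith_moment[OF assms, of k j] in auto)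

lemma has_bochner_integral_erlang_cdf:
  assumes "0 < l"
  shows "has_bochner_integral lborel (\<lambda>z. erlang_density k l z * indicator {..a} z) (erlang_CDF k l a)"
proof (rule has_bochner_integral_nn_integral)
  show "(\<integral>\<^sup>+ z. ennreal (erlang_density k l z * indicator {..a} z) \<partial>lborel) = ennreal (erlang_CDF k l a)"
    using assms nn_integral_erlang_density[OF assms, of k a]
    by (simp add: ennreal_mult ennreal_indicator)
qed (use assms in auto)

lemma sr_power_gain_moments:
  assumes Z: "sr_power_gain M Z m b \<Omega>"
  shows "has_bochner_integral M Z (\<Omega> + 2 * b)"
    and "has_bochner_integral M (\<lambda>\<omega>. (Z \<omega>)\<^sup>2)
           ((\<Omega> + 2 * b)\<^sup>2 + (4 * b\<^sup>2 + 4 * b * \<Omega> + \<Omega>\<^sup>2 / real m))"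
proof -
  have pos: "0 < m" "0 < b" "0 < \<Omega>" using Z by (auto simp: sr_power_gain_def)
  define D where "D = 2 * b * real m + \<Omega>"
  have D: "D > 0" using pos by (simp add: D_def add_pos_pos)
  have A: "sr_beta b - sr_delta m b \<Omega> = real m / D" unfolding D_def by (rule sr_rate_eq[OF pos])
  have A0: "real m / D > 0" using D pos by simp
  let ?B = "\<lambda>i. Bernstein (m - 1) i (\<Omega> / D)"
  have r: "real (m - 1) = real m - 1" using pos by simp
  have "(\<Sum>i\<le>m - 1. ?B i * (fact (i + 1) / (fact i * (real m / D) ^ 1)))
      = (D / real m) * ((\<Sum>i\<le>m - 1. real i * ?B i) + (\<Sum>i\<le>m - 1. ?B i))"
    unfolding sum.distrib[symmetric] sum_distrib_left
    using D pos by (intro sum.cong) (simp_all add: field_simps)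
  also have "\<dots> = \<Omega> + 2 * b"
    using D pos by (simp add: r field_simps) (simp add: D_def algebra_simps)
  finally show "has_bochner_integral M Z (\<Omega> + 2 * b)"
    using has_bochner_integral_sr_power_gain[OF Z, of "\<lambda>z. z ^ 1",
        OF _ has_bochner_integral_erlang_moment] A A0
    by (simp add: D_def)
  \<comment> \<open>The factor (i+2)! / i! = (i+1)(i+2) is rewritten as i(i-1) + 4i + 2, since the
    Bernstein sums are available for factorial moments.\<close>
  have "(\<Sum>i\<le>m - 1. ?B i * (fact (i + 2) / (fact i * (real m / D) ^ 2)))
      = (D / real m)\<^sup>2 * ((\<Sum>i\<le>m - 1. real i * (real i - 1) * ?B i)
           + (4 * (\<Sum>i\<le>m - 1. real i * ?B i) + 2 * (\<Sum>i\<le>m - 1. ?B i)))"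
    unfolding sum.distrib[symmetric] sum_distrib_left
    using D pos by (intro sum.cong) (simp_all add: field_simps power2_eq_square)
  also have "\<dots> = (\<Omega> + 2 * b)\<^sup>2 + (4 * b\<^sup>2 + 4 * b * \<Omega> + \<Omega>\<^sup>2 / real m)"
    unfolding sum_kk_Bernstein sum_k_Bernstein sum_Bernstein
    using D pos by (simp add: r field_simps power2_eq_square) (simp add: D_def algebra_simps)
  finally show "has_bochner_integral M (\<lambda>\<omega>. (Z \<omega>)\<^sup>2)
           ((\<Omega> + 2 * b)\<^sup>2 + (4 * b\<^sup>2 + 4 * b * \<Omega> + \<Omega>\<^sup>2 / real m))"
    using has_bochner_integral_sr_power_gain[OF Z, of "\<lambda>z. z ^ 2",
        OF _ has_bochner_integral_erlang_moment] A A0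
    by (simp add: D_def)
qed

lemma cdf_sr_power_gain:
  assumes Z: "sr_power_gain M Z m b \<Omega>" and a: "0 \<le> a"
  defines "A \<equiv> sr_beta b - sr_delta m b \<Omega>"
  shows "cdf (distr M borel Z) a
    = 1 - (\<Sum>i=0..m - 1. \<Sum>l=0..i. real ((m - 1) choose i) * sr_alpha m b \<Omega> * sr_delta m b \<Omega> ^ i
             * (a ^ l / (fact l * A ^ (i - l + 1))) * exp (- A * a))"
proof -
  have pos: "0 < m" "0 < b" "0 < \<Omega>" and D: "distributed M lborel Z (\<lambda>z. ennreal (sr_density m b \<Omega> z))"
    using Z by (auto simp: sr_power_gain_def)
  have [measurable]: "Z \<in> borel_measurable M" using distributed_measurable[OF D] by simp
  have A0: "A > 0" using pos by (simp add: A_def sr_rate_eq add_pos_pos)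
  let ?B = "\<lambda>i. Bernstein (m - 1) i (\<Omega> / (2 * b * real m + \<Omega>))"
  have "has_bochner_integral M (\<lambda>\<omega>. indicator {..a} (Z \<omega>)) (\<Sum>i\<le>m - 1. ?B i * erlang_CDF i A a)"
    by (rule has_bochner_integral_sr_power_gain[OF Z])
       (use A0 in \<open>auto simp: A_def intro!: has_bochner_integral_erlang_cdf\<close>)
  moreover have "(\<integral>\<omega>. indicator {..a} (Z \<omega>) \<partial>M) = cdf (distr M borel Z) a"
    using integral_distr[of Z M borel "indicator {..a} :: real \<Rightarrow> real"] by (simp add: cdf_def)
  ultimately have "cdf (distr M borel Z) a = (\<Sum>i\<le>m - 1. ?B i * erlang_CDF i A a)"
    by (simp add: has_bochner_integral_iff)
  also have "\<dots> = (\<Sum>i\<le>m - 1. ?B i) - (\<Sum>i\<le>m - 1. ?B i * (\<Sum>l\<le>i. (A * a) ^ l * exp (- A * a) / fact l))"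
    using a by (simp add: erlang_CDF_def right_diff_distrib sum_subtractf)
  also have "(\<Sum>i\<le>m - 1. ?B i * (\<Sum>l\<le>i. (A * a) ^ l * exp (- A * a) / fact l)) =
     (\<Sum>i\<le>m - 1. \<Sum>l\<le>i. real ((m - 1) choose i) * sr_alpha m b \<Omega> * sr_delta m b \<Omega> ^ i
             * (a ^ l / (fact l * A ^ (i - l + 1))) * exp (- A * a))"
  proof (unfold sum_distrib_left, intro sum.cong refl)
    fix i l assume "i \<in> {..m - 1}" "l \<in> {..i}"
    then have i: "i \<le> m - 1" and l: "i = (i - l) + l" by auto
    \<comment> \<open>The l powers of A from the Erlang tail cancel part of the A^(i+1) in the
      weight. As l \<le> i, the natural-number subtraction is exact.\<close>
    have "(A * a) ^ l / A ^ Suc i = a ^ l / A ^ (i - l + 1)"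
      using A0 power_add[of A "i - l" l] l by (simp add: power_mult_distrib)
    moreover have "?B i * ((A * a) ^ l * exp (- A * a) / fact l)
      = real ((m - 1) choose i) * sr_alpha m b \<Omega> * sr_delta m b \<Omega> ^ i / fact l
          * exp (- A * a) * ((A * a) ^ l / A ^ Suc i)"
      unfolding Bernstein_sr[OF pos i, folded A_def] by (simp add: mult_ac)
    ultimately show "?B i * ((A * a) ^ l * exp (- A * a) / fact l)
      = real ((m - 1) choose i) * sr_alpha m b \<Omega> * sr_delta m b \<Omega> ^ i
             * (a ^ l / (fact l * A ^ (i - l + 1))) * exp (- A * a)"
      by (simp add: mult_ac)
  qed
  finally show ?thesis by (simp add: atLeast0AtMost)
qed

section \<open>The Gamma law\<close>

lemma has_bochner_integral_Gamma:
  assumes "0 < (z :: real)"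
  shows "has_bochner_integral lborel (\<lambda>t. indicator {0..} t * t powr (z - 1) / exp t) (Gamma z)"
  by (rule has_bochner_integral_nn_integral)
     (use assms in \<open>auto simp: Gamma_conv_nn_integral_real[OF assms] intro: less_imp_le[OF Gamma_real_pos]\<close>)

lemma gamma_density_nonneg:
  assumes "0 < \<kappa>"
  shows "0 \<le> gamma_density \<kappa> \<Theta> x"
  using Gamma_real_pos[OF assms] by (simp add: gamma_density_def)

lemma gamma_density_measurable [measurable]: "gamma_density \<kappa> \<Theta> \<in> borel_measurable borel"
  unfolding gamma_density_def[abs_def] by measurable

text \<open>Up to constants the integrand is x^(\<kappa>+q-1) exp(-s x) with s = 1/\<Theta> + c, so
  the substitution t = s x leads to Euler's integral for Gamma(\<kappa>+q), and Gamma(\<kappa>+q) /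
  Gamma(\<kappa>) is the rising factorial. The case c = 0 yields total mass and moments; positive c
  serves the averaging of the Erlang tails.\<close>

lemma has_bochner_integral_gamma_density:
  assumes "0 < \<kappa>" "0 < \<Theta>" "0 \<le> c"
  shows "has_bochner_integral lborel (\<lambda>x. gamma_density \<kappa> \<Theta> x * (x ^ q * exp (- c * x)))
           (\<Theta> ^ q * pochhammer \<kappa> q * (1 + \<Theta> * c) powr (- (\<kappa> + real q)))"
proof -
  define s where "s = (1 + \<Theta> * c) / \<Theta>"
  define \<nu> where "\<nu> = \<kappa> + real q"
  \<comment> \<open>Besides the normalisation of the density, \<open>K\<close> removes the power of
    \<open>s\<close> that the substitution puts into the integrand.\<close>
  define K where "K = 1 / (Gamma \<kappa> * \<Theta> powr \<kappa> * s powr (\<nu> - 1))"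
  have c1: "1 + \<Theta> * c > 0" using assms by (simp add: add_pos_nonneg)
  have s: "s > 0" using assms c1 by (simp add: s_def)
  have \<nu>: "\<nu> > 0" using assms by (simp add: \<nu>_def)
  have G: "Gamma \<kappa> > 0" using Gamma_real_pos assms by simp
  have s': "s = 1 / \<Theta> + c" using assms by (simp add: s_def field_simps)
  have "has_bochner_integral lborel
          (\<lambda>x. K * (indicator {0..} (0 + s * x) * (0 + s * x) powr (\<nu> - 1) / exp (0 + s * x)))
          (K * (Gamma \<nu> /\<^sub>R \<bar>s\<bar>))"
    using has_bochner_integral_Gamma[OF \<nu>] s
    by (intro has_bochner_integral_mult_right)
       (subst lborel_has_bochner_integral_real_affine_iff[symmetric], auto)
  moreover have "K * (indicator {0..} (0 + s * x) * (0 + s * x) powr (\<nu> - 1) / exp (0 + s * x))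
       = gamma_density \<kappa> \<Theta> x * (x ^ q * exp (- c * x))" for x
  proof (cases "0 < x")
    case True
    then have "x powr (\<nu> - 1) = x powr (\<kappa> - 1) * x ^ q"
      by (simp add: \<nu>_def powr_add powr_diff powr_realpow)
    moreover have "exp (- (s * x)) = exp (- x / \<Theta>) * exp (- c * x)"
      by (simp add: s' exp_add[symmetric] algebra_simps)
    ultimately show ?thesis
      using True s by (simp add: gamma_density_def K_def powr_mult exp_minus field_simps)
  next
    case False
    \<comment> \<open>At x = 0 the indicator equals 1, and the left side vanishes because
      \<open>0 powr y = 0\<close> for every exponent. For negative x the indicator vanishes.\<close>
    then have "x = 0 \<or> s * x < 0" using s by (auto simp: mult_less_0_iff)
    then show ?thesis using False by (auto simp: gamma_density_def)
  qed
  moreover have "K * (Gamma \<nu> /\<^sub>R \<bar>s\<bar>)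
      = \<Theta> ^ q * pochhammer \<kappa> q * (1 + \<Theta> * c) powr (- (\<kappa> + real q))"
  proof -
    have p: "pochhammer \<kappa> q = Gamma \<nu> / Gamma \<kappa>"
      unfolding \<nu>_def by (rule pochhammer_Gamma) (use assms in auto)
    \<comment> \<open>The Jacobian supplies the missing factor \<open>s\<close>. In the resulting
      power, \<Theta> to the \<kappa> cancels the normalisation of the density and \<Theta> to the q
      survives.\<close>
    have "s powr \<nu> = s powr (\<nu> - 1) * s"
      using s by (simp add: powr_diff)
    moreover have "s powr \<nu> = (1 + \<Theta> * c) powr \<nu> / (\<Theta> powr \<kappa> * \<Theta> ^ q)"
      using assms c1 by (simp add: s_def powr_divide) (simp add: \<nu>_def powr_add powr_realpow)
    ultimately have "s powr (\<nu> - 1) * s = (1 + \<Theta> * c) powr \<nu> / (\<Theta> powr \<kappa> * \<Theta> ^ q)"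
      by simp
    moreover have "K * (Gamma \<nu> /\<^sub>R \<bar>s\<bar>) = Gamma \<nu> / (Gamma \<kappa> * \<Theta> powr \<kappa> * (s powr (\<nu> - 1) * s))"
      using s by (simp add: K_def field_simps)
    ultimately have "K * (Gamma \<nu> /\<^sub>R \<bar>s\<bar>)
        = Gamma \<nu> / (Gamma \<kappa> * \<Theta> powr \<kappa> * ((1 + \<Theta> * c) powr \<nu> / (\<Theta> powr \<kappa> * \<Theta> ^ q)))"
      by simp
    also have "\<dots> = \<Theta> ^ q * pochhammer \<kappa> q * (1 + \<Theta> * c) powr (- (\<kappa> + real q))"
      using assms c1 G unfolding p \<nu>_def[symmetric] powr_minus
      by (simp add: field_simps)
    finally show ?thesis .
  qed
  ultimately show ?thesis by simp
qed

lemma has_bochner_integral_gamma_law: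
  assumes "0 < \<kappa>" "0 < \<Theta>" "0 \<le> c"
  shows "has_bochner_integral (gamma_law \<kappa> \<Theta>) (\<lambda>x. x ^ q * exp (- c * x))
           (\<Theta> ^ q * pochhammer \<kappa> q * (1 + \<Theta> * c) powr (- (\<kappa> + real q)))"
  unfolding gamma_law_def
  by (rule has_bochner_integral_density)
     (use has_bochner_integral_gamma_density[OF assms, of q] assms in \<open>auto simp: gamma_density_nonneg\<close>)

lemma gamma_law_moments:
  assumes "0 < \<kappa>" "0 < \<Theta>"
  shows "prob_space (gamma_law \<kappa> \<Theta>)"
    and "has_bochner_integral (gamma_law \<kappa> \<Theta>) (\<lambda>x. x) (\<kappa> * \<Theta>)"
    and "has_bochner_integral (gamma_law \<kappa> \<Theta>) (\<lambda>x. x\<^sup>2) (\<kappa> * (\<kappa> + 1) * \<Theta>\<^sup>2)"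
proof -
  have "(\<integral>\<^sup>+x. ennreal (gamma_density \<kappa> \<Theta> x) \<partial>lborel) = 1"
    using has_bochner_integral_gamma_density[OF assms, of 0 0] gamma_density_nonneg[OF assms(1)]
    by (simp add: has_bochner_integral_iff nn_integral_eq_integral)
  then show "prob_space (gamma_law \<kappa> \<Theta>)"
    by (intro prob_spaceI) (simp add: gamma_law_def emeasure_density)
  show "has_bochner_integral (gamma_law \<kappa> \<Theta>) (\<lambda>x. x) (\<kappa> * \<Theta>)"
    using has_bochner_integral_gamma_law[OF assms, of 0 1] by (simp add: mult_ac)
  show "has_bochner_integral (gamma_law \<kappa> \<Theta>) (\<lambda>x. x\<^sup>2) (\<kappa> * (\<kappa> + 1) * \<Theta>\<^sup>2)"
    using has_bochner_integral_gamma_law[OF assms, of 0 2]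
    by (simp add: pochhammer_rec numeral_2_eq_2 mult_ac)
qed

lemma AE_gamma_law_pos: "AE x in gamma_law \<kappa> \<Theta>. 0 < x"
  unfolding gamma_law_def by (subst AE_density) (auto simp: gamma_density_def)

section \<open>Sums of independent variables, and outage as an average over the interference\<close>

context prob_space
begin

lemma variance_eq_has_bochner:
  fixes X :: "'a \<Rightarrow> real"
  assumes "has_bochner_integral M X \<mu>" "has_bochner_integral M (\<lambda>\<omega>. (X \<omega>)\<^sup>2) (\<mu>\<^sup>2 + v)"
  shows "variance X = v"
  using assms by (subst variance_eq) (auto simp: has_bochner_integral_iff)

text \<open>Both moments go through one induction. The new summand is independent of the sum so far,
  so the mean of the cross term is the product of the means; it completes the square of the total
  mean, and the variances simply add.\<close>

lemma indep_vars_sum_moments: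
  fixes X :: "'i \<Rightarrow> 'a \<Rightarrow> real"
  assumes "finite J" "indep_vars (\<lambda>_. borel) X J"
    and "\<And>j. j \<in> J \<Longrightarrow> has_bochner_integral M (X j) (\<mu> j)"
    and "\<And>j. j \<in> J \<Longrightarrow> has_bochner_integral M (\<lambda>\<omega>. (X j \<omega>)\<^sup>2) ((\<mu> j)\<^sup>2 + v j)"
  shows "has_bochner_integral M (\<lambda>\<omega>. \<Sum>j\<in>J. X j \<omega>) (\<Sum>j\<in>J. \<mu> j) \<and>
    has_bochner_integral M (\<lambda>\<omega>. (\<Sum>j\<in>J. X j \<omega>)\<^sup>2) ((\<Sum>j\<in>J. \<mu> j)\<^sup>2 + (\<Sum>j\<in>J. v j))"
  using assms
proof (induction J)
  case empty
  then show ?case by (simp add: has_bochner_integral_zero)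
next
  case (insert i J)
  let ?S = "\<lambda>\<omega>. \<Sum>j\<in>J. X j \<omega>"
  have "indep_vars (\<lambda>_. borel) X J"
    using insert.prems(1) by (rule indep_vars_subset) auto
  with insert have IH: "has_bochner_integral M ?S (\<Sum>j\<in>J. \<mu> j)"
    "has_bochner_integral M (\<lambda>\<omega>. (?S \<omega>)\<^sup>2) ((\<Sum>j\<in>J. \<mu> j)\<^sup>2 + (\<Sum>j\<in>J. v j))"
    by auto
  have X: "has_bochner_integral M (X i) (\<mu> i)"
    "has_bochner_integral M (\<lambda>\<omega>. (X i \<omega>)\<^sup>2) ((\<mu> i)\<^sup>2 + v i)"
    using insert.prems by auto
  have ind: "indep_var borel (X i) borel ?S"
    using insert by (intro indep_vars_sum) auto
  have XS: "has_bochner_integral M (\<lambda>\<omega>. X i \<omega> * ?S \<omega>) (\<mu> i * (\<Sum>j\<in>J. \<mu> j))"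
    using indep_var_integrable[OF ind] indep_var_lebesgue_integral[OF ind] X(1) IH(1)
    by (simp add: has_bochner_integral_iff)
  have "has_bochner_integral M (\<lambda>\<omega>. (X i \<omega>)\<^sup>2 + 2 * (X i \<omega> * ?S \<omega>) + (?S \<omega>)\<^sup>2)
     (((\<mu> i)\<^sup>2 + v i) + 2 * (\<mu> i * (\<Sum>j\<in>J. \<mu> j)) + ((\<Sum>j\<in>J. \<mu> j)\<^sup>2 + (\<Sum>j\<in>J. v j)))"
    by (intro has_bochner_integral_add has_bochner_integral_mult_right X XS IH)
  moreover have "has_bochner_integral M (\<lambda>\<omega>. X i \<omega> + ?S \<omega>) (\<mu> i + (\<Sum>j\<in>J. \<mu> j))"
    by (intro has_bochner_integral_add X IH)
  ultimately show ?case
    using insert.hyps by (simp add: power2_sum algebra_simps)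
qed

text \<open>By independence the joint law is a product, and Fubini integrates over \<open>X\<close>
  first: for a fixed value y of \<open>Y\<close> the inner integral is the probability that
  \<open>X\<close> lies below t (y + N0).\<close>

lemma prob_less_affine_eq_outage_average:
  assumes ind: "indep_var borel X borel Y"
    and X: "distributed M lborel X f"
  shows "\<P>(\<omega> in M. X \<omega> < t * (Y \<omega> + N0)) = outage_average (distr M borel X) t N0 (distr M borel Y)"
proof -
  have [measurable]: "random_variable borel X" "random_variable borel Y"
    using ind by (auto dest: indep_var_rv1 indep_var_rv2)
  interpret X: prob_space "distr M borel X" by (rule prob_space_distr) simp
  interpret Y: prob_space "distr M borel Y" by (rule prob_space_distr) simp
  interpret P: pair_prob_space "distr M borel X" "distr M borel Y" ..
  have D: "distr M borel X = density lborel f"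
    using X by (simp add: distributed_def cong: distr_cong)
  \<comment> \<open>No atom at \<open>c\<close>, as \<open>X\<close> has a density: the strict inequality may become the weak one of \<open>cdf\<close>.\<close>
  have le: "X.prob {..<c} = cdf (distr M borel X) c" for c
  proof -
    have "emeasure (distr M borel X) {c} = 0"
      unfolding D using X by (subst emeasure_density) (auto simp: distributed_def nn_integral_0_iff_AE)
    then have "AE x in distr M borel X. x \<noteq> c"
      by (intro AE_I'[of "{c}"]) auto
    then have "AE x in distr M borel X. x \<in> {..<c} \<longleftrightarrow> x \<in> {..c}"
      by eventually_elim auto
    then show ?thesis
      unfolding cdf_def by (intro measure_eq_AE) auto
  qed
  let ?A = "{p :: real \<times> real. fst p < t * (snd p + N0)}"
  have "?A = {p \<in> space (borel \<Otimes>\<^sub>M borel). fst p < t * (snd p + N0)}"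
    by (simp add: space_pair_measure)
  also have "\<dots> \<in> sets (borel \<Otimes>\<^sub>M borel)" by measurable
  finally have [measurable]: "?A \<in> sets (borel \<Otimes>\<^sub>M borel)" .
  have "\<P>(\<omega> in M. X \<omega> < t * (Y \<omega> + N0))
      = measure (distr M (borel \<Otimes>\<^sub>M borel) (\<lambda>\<omega>. (X \<omega>, Y \<omega>))) ?A"
    by (subst measure_distr) (auto intro!: arg_cong[of _ _ prob])
  also have "\<dots> = measure (distr M borel X \<Otimes>\<^sub>M distr M borel Y) ?A"
    using ind by (simp add: indep_var_distribution_eq)
  also have "\<dots> = (\<integral>p. indicator ?A p \<partial>(distr M borel X \<Otimes>\<^sub>M distr M borel Y))"
    by (simp add: space_pair_measure)
  also have "\<dots> = (\<integral>y. \<integral>x. indicator ?A (x, y) \<partial>distr M borel X \<partial>distr M borel Y)"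
    by (subst P.integral_snd) (auto intro!: P.integrable_const_bound[of _ 1])
  also have "\<dots> = (\<integral>y. X.prob {..<t * (y + N0)} \<partial>distr M borel Y)"
  proof (intro Bochner_Integration.integral_cong refl)
    fix y
    have "(\<lambda>x. indicator ?A (x, y) :: real) = indicator {..<t * (y + N0)}"
      by (auto simp: indicator_def fun_eq_iff)
    then show "(\<integral>x. indicator ?A (x, y) \<partial>distr M borel X) = X.prob {..<t * (y + N0)}"
      by simp
  qed
  finally show ?thesis by (simp add: le outage_average_def)
qed

end

section \<open>Closed form of the Gamma average\<close>

text \<open>The sum over q comes from expanding (x + N0)^l by the binomial theorem. The exponential
  splits into the constant exp(-A t N0) and exp(-A t x), so each term is a Gamma integral with c = A
  t.\<close>

lemma outage_average_gamma_law:
  assumes Z: "sr_power_gain M Z m b \<Omega>" and "prob_space M"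
    and pos: "0 < \<kappa>" "0 < \<Theta>" "0 \<le> N0" "0 \<le> t"
  defines "A \<equiv> sr_beta b - sr_delta m b \<Omega>"
  shows "outage_average (distr M borel Z) t N0 (gamma_law \<kappa> \<Theta>)
    = 1 - (\<Sum>i=0..m - 1. \<Sum>l=0..i. \<Sum>q=0..l.
             real ((m - 1) choose i) * real (l choose q) * sr_alpha m b \<Omega> * sr_delta m b \<Omega> ^ i
             * exp (- (A * t) * N0) * (t ^ l / (fact l * A ^ (i - l + 1))) * N0 ^ (l - q) * \<Theta> ^ q
             * pochhammer \<kappa> q * (1 + \<Theta> * (A * t)) powr (- (\<kappa> + real q)))"
proof -
  let ?\<nu> = "distr M borel Z" and ?G = "gamma_law \<kappa> \<Theta>"
  let ?c = "\<lambda>i l q. real ((m - 1) choose i) * real (l choose q) * sr_alpha m b \<Omega> * sr_delta m b \<Omega> ^ i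
             * exp (- (A * t) * N0) * (t ^ l / (fact l * A ^ (i - l + 1))) * N0 ^ (l - q)"
  have "0 < m" "0 < b" "0 < \<Omega>" and D: "distributed M lborel Z (\<lambda>z. ennreal (sr_density m b \<Omega> z))"
    using Z by (auto simp: sr_power_gain_def)
  then have A0: "0 \<le> A * t" using pos by (simp add: A_def sr_rate_eq)
  have [measurable]: "Z \<in> borel_measurable M" using distributed_measurable[OF D] by simp
  interpret prob_space M by fact
  interpret \<nu>: prob_space ?\<nu> by (rule prob_space_distr) simp
  interpret \<nu>: real_distribution ?\<nu> by unfold_locales simp_all
  interpret G: prob_space ?G using gamma_law_moments(1) pos by blast
  have [measurable]: "cdf ?\<nu> \<in> borel_measurable borel"
    by (intro borel_measurable_mono monoI \<nu>.cdf_nondecreasing)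
  have [measurable_cong, simp]: "sets ?G = sets borel" by (simp add: gamma_law_def)
  \<comment> \<open>The formula for the distribution function holds at nonnegative arguments only,
    hence almost everywhere: the Gamma law is carried by x > 0.\<close>
  have "AE x in ?G. cdf ?\<nu> (t * (x + N0))
      = 1 - (\<Sum>i=0..m - 1. \<Sum>l=0..i. \<Sum>q=0..l. ?c i l q * (x ^ q * exp (- (A * t) * x)))"
    using AE_gamma_law_pos
  proof eventually_elim
    case (elim x)
    have "real ((m - 1) choose i) * sr_alpha m b \<Omega> * sr_delta m b \<Omega> ^ i
             * ((t * (x + N0)) ^ l / (fact l * A ^ (i - l + 1))) * exp (- A * (t * (x + N0)))
        = (\<Sum>q=0..l. ?c i l q * (x ^ q * exp (- (A * t) * x)))" for i l
    proof -
      have e: "exp (- A * (t * (x + N0))) = exp (- (A * t) * N0) * exp (- (A * t) * x)"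
        by (simp add: exp_add[symmetric] algebra_simps)
      have "(t * (x + N0)) ^ l = t ^ l * (\<Sum>q=0..l. real (l choose q) * x ^ q * N0 ^ (l - q))"
        by (simp add: power_mult_distrib binomial_ring atLeast0AtMost)
      then show ?thesis
        unfolding e by (simp add: sum_distrib_left sum_distrib_right sum_divide_distrib mult_ac)
    qed
    then show ?case
      using elim pos by (subst cdf_sr_power_gain[OF Z]) (simp_all add: A_def)
  qed
  then have "outage_average ?\<nu> t N0 ?G
      = (\<integral>x. 1 - (\<Sum>i=0..m - 1. \<Sum>l=0..i. \<Sum>q=0..l. ?c i l q * (x ^ q * exp (- (A * t) * x))) \<partial>?G)"
    unfolding outage_average_def by (intro integral_cong_AE) auto
  also have "\<dots> = 1 - (\<Sum>i=0..m - 1. \<Sum>l=0..i. \<Sum>q=0..l.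
      ?c i l q * (\<Theta> ^ q * pochhammer \<kappa> q * (1 + \<Theta> * (A * t)) powr (- (\<kappa> + real q))))"
  proof (rule has_bochner_integral_integral_eq,
      intro has_bochner_integral_diff has_bochner_integral_sum has_bochner_integral_mult_right
        has_bochner_integral_gamma_law pos A0)
    show "has_bochner_integral ?G (\<lambda>x. 1) (1 :: real)"
      by (simp add: has_bochner_integral_iff G.prob_space)
  qed
  finally show ?thesis by (simp add: mult.assoc)
qed

section \<open>The outage events and their nesting\<close>

lemma AE_sr_power_gain_nonneg:
  assumes "sr_power_gain M Z m b \<Omega>"
  shows "AE \<omega> in M. 0 \<le> Z \<omega>"
proof -
  have D: "distributed M lborel Z (\<lambda>z. ennreal (sr_density m b \<Omega> z))"
    using assms by (auto simp: sr_power_gain_def)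
  then have "AE z in density lborel (\<lambda>z. ennreal (sr_density m b \<Omega> z)). 0 \<le> z"
    by (subst AE_density) (auto simp: distributed_def sr_density_def)
  then have "AE z in distr M lborel Z. 0 \<le> z"
    by (simp only: distributed_distr_eq_density[OF D])
  then show ?thesis by (rule AE_distrD[OF distributed_measurable[OF D]])
qed

text \<open>The noise makes the denominator positive even at z = 0. Here r is the power fraction of
  the streams not yet removed: 1 - \<zeta>c for the common stream, the sum over the other users for
  the private one. The sign of \<zeta> - \<gamma> r is left open.\<close>

lemma SINR_less_iff:
  fixes P L \<zeta> r z x N0 \<gamma> :: real
  assumes "0 < P" "0 < L" "0 \<le> r" "0 \<le> z" "0 \<le> x" "0 < N0"
  shows "P * \<zeta> * z * L / (P * r * z * L + x + N0) < \<gamma>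
    \<longleftrightarrow> P * L * (\<zeta> - \<gamma> * r) * z < \<gamma> * (x + N0)"
proof -
  have "0 < P * r * z * L + x + N0"
    using assms by (intro add_nonneg_pos add_nonneg_nonneg mult_nonneg_nonneg) auto
  then show ?thesis by (simp add: divide_less_eq algebra_simps)
qed

context prob_space
begin

lemma prob_disj_nested:
  assumes [measurable]: "Measurable.pred M E" "Measurable.pred M F"
    and nested: "(AE \<omega> in M. F \<omega> \<longrightarrow> E \<omega>) \<or> (AE \<omega> in M. E \<omega> \<longrightarrow> F \<omega>)"
  shows "\<P>(\<omega> in M. E \<omega> \<or> F \<omega>) = max (\<P>(\<omega> in M. E \<omega>)) (\<P>(\<omega> in M. F \<omega>))"
  using nested
proof
  assume F: "AE \<omega> in M. F \<omega> \<longrightarrow> E \<omega>"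
  then have "\<P>(\<omega> in M. E \<omega> \<or> F \<omega>) = \<P>(\<omega> in M. E \<omega>)"
    by (intro prob_eq_AE) auto
  moreover have "\<P>(\<omega> in M. F \<omega>) \<le> \<P>(\<omega> in M. E \<omega>)"
    using F by (intro finite_measure_mono_AE) auto
  ultimately show ?thesis by simp
next
  assume E: "AE \<omega> in M. E \<omega> \<longrightarrow> F \<omega>"
  then have "\<P>(\<omega> in M. E \<omega> \<or> F \<omega>) = \<P>(\<omega> in M. F \<omega>)"
    by (intro prob_eq_AE) auto
  moreover have "\<P>(\<omega> in M. E \<omega>) \<le> \<P>(\<omega> in M. F \<omega>)"
    using E by (intro finite_measure_mono_AE) auto
  ultimately show ?thesis by simp
qed

end

theorem proposition2:
  fixes M :: "'a measure"
    and K N k n :: nat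
    and m :: "nat \<Rightarrow> nat"
    and b \<Omega> P L \<zeta> :: "nat \<Rightarrow> real"
    and Z :: "nat \<Rightarrow> 'a \<Rightarrow> real"
    and N0 \<zeta>c Rc Rp :: real
    and \<alpha> \<delta> A1 \<gamma>c \<gamma>p \<mu> \<sigma>2 \<kappa> \<Theta> A2 A3 tc tp V1 V2 Pout Pc Pp :: real
    and I SINRc SINRp :: "'a \<Rightarrow> real"
  assumes "prob_space M"
    and "2 \<le> K" and "k \<in> {1..K}" and "n \<in> {1..N}"
    and "\<And>l. l \<in> {1..K} \<Longrightarrow> sr_power_gain M (Z l) (m l) (b l) (\<Omega> l)"
    and "prob_space.indep_vars M (\<lambda>_. borel) Z {1..K}"
    and "\<And>l. l \<in> {1..K} \<Longrightarrow> 0 < P l" and "\<And>l. l \<in> {1..K} \<Longrightarrow> 0 < L l"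
    and "0 < N0"
    and "0 \<le> \<zeta>c" and "\<And>j. j \<in> {1..N} \<Longrightarrow> 0 \<le> \<zeta> j" and "\<zeta>c + (\<Sum>j=1..N. \<zeta> j) = 1"
    and "0 < Rc" and "0 < Rp"
    and "\<alpha> = sr_alpha (m k) (b k) (\<Omega> k)"
    and "\<delta> = sr_delta (m k) (b k) (\<Omega> k)"
    and "A1 = sr_beta (b k) - sr_delta (m k) (b k) (\<Omega> k)"
    and "I = (\<lambda>\<omega>. \<Sum>l\<in>{1..K} - {k}. P l * L l * Z l \<omega>)"
    and "\<gamma>c = 2 powr Rc - 1"
    and "\<gamma>p = 2 powr Rp - 1"
    and "SINRc = (\<lambda>\<omega>. P k * \<zeta>c * Z k \<omega> * L k
                        / (P k * (1 - \<zeta>c) * Z k \<omega> * L k + I \<omega> + N0))"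
    and "SINRp = (\<lambda>\<omega>. P k * \<zeta> n * Z k \<omega> * L k
                        / ((\<Sum>j\<in>{1..N} - {n}. P k * \<zeta> j * Z k \<omega> * L k) + I \<omega> + N0))"
    and "Pout = \<P>(\<omega> in M. SINRc \<omega> < \<gamma>c \<or> SINRp \<omega> < \<gamma>p)"
    and "Pc = \<P>(\<omega> in M. SINRc \<omega> < \<gamma>c)"
    and "Pp = \<P>(\<omega> in M. SINRp \<omega> < \<gamma>p)"
    and "\<mu> = (\<Sum>l\<in>{1..K} - {k}. P l * L l * (\<Omega> l + 2 * b l))"
    and "\<sigma>2 = (\<Sum>l\<in>{1..K} - {k}.
                 (P l * L l)\<^sup>2 * (4 * (b l)\<^sup>2 + 4 * b l * \<Omega> l + (\<Omega> l)\<^sup>2 / real (m l)))"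
    and "\<kappa> = \<mu>\<^sup>2 / \<sigma>2"
    and "\<Theta> = \<sigma>2 / \<mu>"
    and "A2 = P k * L k * (\<zeta>c - \<gamma>c * (1 - \<zeta>c))"
    and "A3 = P k * L k * (\<zeta> n - \<gamma>p * (\<Sum>j\<in>{1..N} - {n}. \<zeta> j))"
    and "tc = \<gamma>c / A2"
    and "tp = \<gamma>p / A3"
    and "V1 = A1 * tc"
    and "V2 = A1 * tp"
  shows "(Pout = max Pc Pp)
    \<and> (integrable M I \<and> prob_space.expectation M I = \<mu>
           \<and> integrable M (\<lambda>\<omega>. (I \<omega>)\<^sup>2) \<and> prob_space.variance M I = \<sigma>2)
    \<and> (prob_space (gamma_law \<kappa> \<Theta>)
           \<and> integrable (gamma_law \<kappa> \<Theta>) (\<lambda>x. x)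
           \<and> prob_space.expectation (gamma_law \<kappa> \<Theta>) (\<lambda>x. x) = \<mu>
           \<and> integrable (gamma_law \<kappa> \<Theta>) (\<lambda>x. x\<^sup>2)
           \<and> prob_space.variance (gamma_law \<kappa> \<Theta>) (\<lambda>x. x) = \<sigma>2)
    \<and> (A2 > 0 \<longrightarrow>
           Pc = outage_average (distr M borel (Z k)) tc N0 (distr M borel I)
         \<and> outage_average (distr M borel (Z k)) tc N0 (gamma_law \<kappa> \<Theta>)
             = 1 - (\<Sum>i=0..m k - 1. \<Sum>l=0..i. \<Sum>q=0..l.
                 real ((m k - 1) choose i) * real (l choose q) * \<alpha> * \<delta> ^ i * exp (- V1 * N0)
                 * (tc ^ l / (fact l * A1 ^ (i - l + 1))) * N0 ^ (l - q) * \<Theta> ^ q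
                 * pochhammer \<kappa> q * (1 + \<Theta> * V1) powr (- (\<kappa> + real q))))
    \<and> (A3 > 0 \<longrightarrow>
           Pp = outage_average (distr M borel (Z k)) tp N0 (distr M borel I)
         \<and> outage_average (distr M borel (Z k)) tp N0 (gamma_law \<kappa> \<Theta>)
             = 1 - (\<Sum>i=0..m k - 1. \<Sum>l=0..i. \<Sum>q=0..l.
                 real ((m k - 1) choose i) * real (l choose q) * \<alpha> * \<delta> ^ i * exp (- V2 * N0)
                 * (tp ^ l / (fact l * A1 ^ (i - l + 1))) * N0 ^ (l - q) * \<Theta> ^ q
                 * pochhammer \<kappa> q * (1 + \<Theta> * V2) powr (- (\<kappa> + real q))))
    \<and> (A2 \<le> 0 \<longrightarrow> Pc = 1)
    \<and> (A3 \<le> 0 \<longrightarrow> Pp = 1)"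
proof -
  interpret prob_space M by fact
  note k = \<open>k \<in> {1..K}\<close> and N0 = \<open>0 < N0\<close>
  note sr = assms(5) and indep = assms(6) and P = assms(7) and L = assms(8)
  note I_def = \<open>I = _\<close> and SINRc_def = \<open>SINRc = _\<close> and SINRp_def = \<open>SINRp = _\<close>
  let ?J = "{1..K} - {k}"
  let ?\<mu> = "\<lambda>l. P l * L l * (\<Omega> l + 2 * b l)"
    and ?v = "\<lambda>l. (P l * L l)\<^sup>2 * (4 * (b l)\<^sup>2 + 4 * b l * \<Omega> l + (\<Omega> l)\<^sup>2 / real (m l))"
  \<comment> \<open>At least one interfering beam exists because K \<ge> 2. This makes \<mu> and
    \<sigma>2 strictly positive, so that \<kappa> and \<Theta> are valid Gamma parameters.\<close>
  have J: "?J \<noteq> {}"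
  proof -
    have "card ?J > 0" using k \<open>2 \<le> K\<close> by simp
    then show ?thesis by (metis card.empty less_irrefl)
  qed
  have par: "0 < m l" "0 < b l" "0 < \<Omega> l" if "l \<in> {1..K}" for l
    using sr[OF that] by (auto simp: sr_power_gain_def)
  have [measurable]: "Z l \<in> borel_measurable M" if "l \<in> {1..K}" for l
    using indep that by (auto simp: indep_vars_def)
  have [measurable]: "Z k \<in> borel_measurable M" "I \<in> borel_measurable M"
    unfolding I_def using k by measurable

  \<comment> \<open>The whole family is rescaled at once, with factor 1 at \<open>k\<close>, so that
    splitting off the index \<open>k\<close> leaves \<open>Z k\<close> itself on one side and
    exactly \<open>I\<close> on the other.\<close>
  have "indep_vars (\<lambda>_. borel) (\<lambda>l \<omega>. (if l = k then 1 else P l * L l) * Z l \<omega>) {1..K}"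
    by (rule indep_vars_compose2[OF indep]) measurable
  moreover have "insert k ?J = {1..K}" using k by auto
  ultimately have "indep_var borel (\<lambda>\<omega>. (if k = k then 1 else P k * L k) * Z k \<omega>)
      borel (\<lambda>\<omega>. \<Sum>l\<in>?J. (if l = k then 1 else P l * L l) * Z l \<omega>)"
    by (intro indep_vars_sum) auto
  moreover have "(\<lambda>\<omega>. \<Sum>l\<in>?J. (if l = k then 1 else P l * L l) * Z l \<omega>) = I"
    unfolding I_def by (intro ext sum.cong) auto
  ultimately have ZI: "indep_var borel (Z k) borel I" by simp

  have "has_bochner_integral M (\<lambda>\<omega>. \<Sum>l\<in>?J. P l * L l * Z l \<omega>) (\<Sum>l\<in>?J. ?\<mu> l) \<and>
      has_bochner_integral M (\<lambda>\<omega>. (\<Sum>l\<in>?J. P l * L l * Z l \<omega>)\<^sup>2) ((\<Sum>l\<in>?J. ?\<mu> l)\<^sup>2 + (\<Sum>l\<in>?J. ?v l))"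
  proof (rule indep_vars_sum_moments)
    show "indep_vars (\<lambda>_. borel) (\<lambda>l \<omega>. P l * L l * Z l \<omega>) ?J"
      by (rule indep_vars_compose2[OF indep_vars_subset[OF indep]]) auto
    fix l assume "l \<in> ?J"
    then have Z: "sr_power_gain M (Z l) (m l) (b l) (\<Omega> l)" using sr by auto
    show "has_bochner_integral M (\<lambda>\<omega>. P l * L l * Z l \<omega>) (?\<mu> l)"
      by (intro has_bochner_integral_mult_right sr_power_gain_moments(1)[OF Z])
    show "has_bochner_integral M (\<lambda>\<omega>. (P l * L l * Z l \<omega>)\<^sup>2) ((?\<mu> l)\<^sup>2 + ?v l)"
      using has_bochner_integral_mult_right[OF sr_power_gain_moments(2)[OF Z], of "(P l * L l)\<^sup>2"]
      by (simp only: power_mult_distrib[of "P l * L l"] distrib_left[symmetric])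
  qed simp
  then have I: "has_bochner_integral M I \<mu>" "has_bochner_integral M (\<lambda>\<omega>. (I \<omega>)\<^sup>2) (\<mu>\<^sup>2 + \<sigma>2)"
    by (simp_all add: I_def \<open>\<mu> = _\<close> \<open>\<sigma>2 = _\<close>)

  have "0 < \<mu>" "0 < \<sigma>2"
  proof -
    have pos: "0 < ?\<mu> l \<and> 0 < ?v l" if "l \<in> ?J" for l
    proof -
      have "0 < P l" "0 < L l" "0 < m l" "0 < b l" "0 < \<Omega> l"
        using that P L par by auto
      then show ?thesis by (simp add: add_pos_pos)
    qed
    show "0 < \<mu>"
      unfolding \<open>\<mu> = _\<close> by (rule sum_pos[OF _ J]) (simp, rule pos[THEN conjunct1])
    show "0 < \<sigma>2"
      unfolding \<open>\<sigma>2 = _\<close> by (rule sum_pos[OF _ J]) (simp, rule pos[THEN conjunct2])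
  qed
  \<comment> \<open>Moment matching: \<kappa> and \<Theta> solve \<kappa> \<Theta> = \<mu> and
    \<kappa> \<Theta>^2 = \<sigma>2, so the second Gamma moment agrees with that of
    \<open>I\<close>.\<close>
  then have \<kappa>\<Theta>: "0 < \<kappa>" "0 < \<Theta>" "\<kappa> * \<Theta> = \<mu>" "\<kappa> * (\<kappa> + 1) * \<Theta>\<^sup>2 = \<mu>\<^sup>2 + \<sigma>2"
    by (simp_all add: \<open>\<kappa> = _\<close> \<open>\<Theta> = _\<close> field_simps power2_eq_square)
  interpret G: prob_space "gamma_law \<kappa> \<Theta>" using gamma_law_moments(1) \<kappa>\<Theta> by blast
  have G: "has_bochner_integral (gamma_law \<kappa> \<Theta>) (\<lambda>x. x) \<mu>"
    "has_bochner_integral (gamma_law \<kappa> \<Theta>) (\<lambda>x. x\<^sup>2) (\<mu>\<^sup>2 + \<sigma>2)"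
    using gamma_law_moments(2,3)[of \<kappa> \<Theta>] \<kappa>\<Theta> by simp_all

  have \<gamma>: "0 < \<gamma>c" "0 < \<gamma>p"
    using \<open>0 < Rc\<close> \<open>0 < Rp\<close> by (simp_all add: \<open>\<gamma>c = _\<close> \<open>\<gamma>p = _\<close>)
  have AE_Z: "AE \<omega> in M. 0 \<le> Z k \<omega>"
    using AE_sr_power_gain_nonneg[OF sr[OF k]] .
  have "AE \<omega> in M. \<forall>l\<in>?J. 0 \<le> Z l \<omega>"
    by (intro AE_finite_allI) (auto intro: AE_sr_power_gain_nonneg[OF sr])
  then have AE_I: "AE \<omega> in M. 0 \<le> I \<omega>"
    unfolding I_def
    by eventually_elim
       (auto intro!: sum_nonneg mult_nonneg_nonneg less_imp_le[OF P] less_imp_le[OF L])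
  have \<zeta>: "0 \<le> 1 - \<zeta>c" "0 \<le> (\<Sum>j\<in>{1..N} - {n}. \<zeta> j)"
  proof -
    have "0 \<le> (\<Sum>j=1..N. \<zeta> j)" by (intro sum_nonneg assms(11))
    then show "0 \<le> 1 - \<zeta>c" using assms(12) by simp
    show "0 \<le> (\<Sum>j\<in>{1..N} - {n}. \<zeta> j)" by (intro sum_nonneg assms(11)) auto
  qed
  have c: "AE \<omega> in M. SINRc \<omega> < \<gamma>c \<longleftrightarrow> A2 * Z k \<omega> < \<gamma>c * (I \<omega> + N0)"
    using AE_Z AE_I unfolding SINRc_def \<open>A2 = _\<close>
    by eventually_elim (rule SINR_less_iff, use P L k \<zeta> N0 in auto)
  have p: "AE \<omega> in M. SINRp \<omega> < \<gamma>p \<longleftrightarrow> A3 * Z k \<omega> < \<gamma>p * (I \<omega> + N0)"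
    using AE_Z AE_I
  proof eventually_elim
    case (elim \<omega>)
    have "(\<Sum>j\<in>{1..N} - {n}. P k * \<zeta> j * Z k \<omega> * L k)
        = P k * (\<Sum>j\<in>{1..N} - {n}. \<zeta> j) * Z k \<omega> * L k"
      by (simp add: sum_distrib_left sum_distrib_right)
    then show ?case
      using SINR_less_iff[of "P k" "L k" "\<Sum>j\<in>{1..N} - {n}. \<zeta> j" "Z k \<omega>" "I \<omega>" N0 "\<zeta> n" \<gamma>p]
        elim P L k \<zeta> N0 by (simp add: SINRp_def \<open>A3 = _\<close>)
  qed
  have [measurable]: "SINRc \<in> borel_measurable M" "SINRp \<in> borel_measurable M"
    unfolding SINRc_def SINRp_def by measurable

  \<comment> \<open>Stated for a generic ratio \<open>S\<close> and coefficient \<open>a\<close>, to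
    serve both streams with \<open>a\<close> equal to \<open>A2\<close> or
    \<open>A3\<close>.\<close>
  have outage: "(0 < a \<longrightarrow> \<P>(\<omega> in M. S \<omega> < \<gamma>)
        = outage_average (distr M borel (Z k)) (\<gamma> / a) N0 (distr M borel I))
      \<and> (a \<le> 0 \<longrightarrow> \<P>(\<omega> in M. S \<omega> < \<gamma>) = 1)"
    if S: "AE \<omega> in M. S \<omega> < \<gamma> \<longleftrightarrow> a * Z k \<omega> < \<gamma> * (I \<omega> + N0)"
      and [measurable]: "S \<in> borel_measurable M" and "0 < \<gamma>" for S :: "'a \<Rightarrow> real" and \<gamma> a
  proof (intro conjI impI)
    assume a: "0 < a"
    have "\<P>(\<omega> in M. S \<omega> < \<gamma>) = \<P>(\<omega> in M. Z k \<omega> < \<gamma> / a * (I \<omega> + N0))"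
    proof (rule prob_eq_AE)
      show "AE \<omega> in M. S \<omega> < \<gamma> \<longleftrightarrow> Z k \<omega> < \<gamma> / a * (I \<omega> + N0)"
        using S by eventually_elim (use a in \<open>simp add: field_simps\<close>)
    qed measurable
    also have "\<dots> = outage_average (distr M borel (Z k)) (\<gamma> / a) N0 (distr M borel I)"
      using sr[OF k] by (intro prob_less_affine_eq_outage_average[OF ZI]) (auto simp: sr_power_gain_def)
    finally show "\<P>(\<omega> in M. S \<omega> < \<gamma>)
        = outage_average (distr M borel (Z k)) (\<gamma> / a) N0 (distr M borel I)" .
  next
    assume a: "a \<le> 0"
    have "AE \<omega> in M. S \<omega> < \<gamma>"
      using S AE_Z AE_I
    proof eventually_elim
      case (elim \<omega>)
      \<comment> \<open>With a nonpositive coefficient no gain, however large, reaches the target,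
        while the right-hand side is positive thanks to the noise.\<close>
      have "a * Z k \<omega> \<le> 0" using a elim by (simp add: mult_nonpos_nonneg)
      also have "0 < \<gamma> * (I \<omega> + N0)" using \<open>0 < \<gamma>\<close> elim N0 by simp
      finally show ?case using elim by simp
    qed
    then show "\<P>(\<omega> in M. S \<omega> < \<gamma>) = 1"
      by (subst prob_Collect_eq_1) auto
  qed

  \<comment> \<open>Dividing by the threshold gives both events the same right-hand side I + N0. As
    the gain is nonnegative, the larger ratio a / \<gamma> belongs to the smaller event.\<close>
  have mono: "AE \<omega> in M. S' \<omega> < \<gamma>' \<longrightarrow> S \<omega> < \<gamma>"
    if "AE \<omega> in M. S \<omega> < \<gamma> \<longleftrightarrow> a * Z k \<omega> < \<gamma> * (I \<omega> + N0)"
      "AE \<omega> in M. S' \<omega> < \<gamma>' \<longleftrightarrow> a' * Z k \<omega> < \<gamma>' * (I \<omega> + N0)"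
      and \<gamma>: "0 < \<gamma>" "0 < \<gamma>'" and le: "a / \<gamma> \<le> a' / \<gamma>'"
    for S S' :: "'a \<Rightarrow> real" and \<gamma> \<gamma>' a a'
    using that(1,2) AE_Z
  proof eventually_elim
    case (elim \<omega>)
    show ?case
    proof
      assume "S' \<omega> < \<gamma>'"
      then have "a' / \<gamma>' * Z k \<omega> < I \<omega> + N0" using elim \<gamma> by (simp add: field_simps)
      moreover have "a / \<gamma> * Z k \<omega> \<le> a' / \<gamma>' * Z k \<omega>" using le elim by (intro mult_right_mono)
      ultimately have "a / \<gamma> * Z k \<omega> < I \<omega> + N0" by simp
      then show "S \<omega> < \<gamma>" using elim \<gamma> by (simp add: field_simps)
    qed
  qed
  have out: "Pout = max Pc Pp"
    unfolding \<open>Pout = _\<close> \<open>Pc = _\<close> \<open>Pp = _\<close>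
  proof (rule prob_disj_nested)
    show "(AE \<omega> in M. SINRp \<omega> < \<gamma>p \<longrightarrow> SINRc \<omega> < \<gamma>c) \<or> (AE \<omega> in M. SINRc \<omega> < \<gamma>c \<longrightarrow> SINRp \<omega> < \<gamma>p)"
      using mono[OF c p \<gamma>] mono[OF p c \<gamma>(2,1)] by linarith
  qed measurable

  note gamma = outage_average_gamma_law[OF sr[OF k] \<open>prob_space M\<close> \<kappa>\<Theta>(1,2) less_imp_le[OF N0]]
  note defs = \<open>V1 = _\<close> \<open>V2 = _\<close> \<open>A1 = _\<close> \<open>\<alpha> = _\<close> \<open>\<delta> = _\<close>
  show ?thesis
  proof (intro conjI impI)
    show "Pout = max Pc Pp" by (fact out)
    show "integrable M I" "expectation I = \<mu>" "integrable M (\<lambda>\<omega>. (I \<omega>)\<^sup>2)" "variance I = \<sigma>2"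
      using I variance_eq_has_bochner[OF I] by (auto simp: has_bochner_integral_iff)
    show "prob_space (gamma_law \<kappa> \<Theta>)" by (fact G.prob_space_axioms)
    show "integrable (gamma_law \<kappa> \<Theta>) (\<lambda>x. x)" "G.expectation (\<lambda>x. x) = \<mu>"
      "integrable (gamma_law \<kappa> \<Theta>) (\<lambda>x. x\<^sup>2)" "G.variance (\<lambda>x. x) = \<sigma>2"
      using G G.variance_eq_has_bochner[OF G] by (auto simp: has_bochner_integral_iff)
    show "Pc = outage_average (distr M borel (Z k)) tc N0 (distr M borel I)" if "A2 > 0"
      using outage[OF c _ \<gamma>(1)] that by (simp add: \<open>Pc = _\<close> \<open>tc = _\<close>)
    show "Pp = outage_average (distr M borel (Z k)) tp N0 (distr M borel I)" if "A3 > 0"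
      using outage[OF p _ \<gamma>(2)] that by (simp add: \<open>Pp = _\<close> \<open>tp = _\<close>)
    show "Pc = 1" if "A2 \<le> 0"
      using outage[OF c _ \<gamma>(1)] that by (simp add: \<open>Pc = _\<close>)
    show "Pp = 1" if "A3 \<le> 0"
      using outage[OF p _ \<gamma>(2)] that by (simp add: \<open>Pp = _\<close>)
  next
    assume "A2 > 0"
    then have "0 \<le> tc" using \<gamma> by (simp add: \<open>tc = _\<close>)
    from gamma[OF this] show "outage_average (distr M borel (Z k)) tc N0 (gamma_law \<kappa> \<Theta>)
             = 1 - (\<Sum>i=0..m k - 1. \<Sum>l=0..i. \<Sum>q=0..l.
                 real ((m k - 1) choose i) * real (l choose q) * \<alpha> * \<delta> ^ i * exp (- V1 * N0)
                 * (tc ^ l / (fact l * A1 ^ (i - l + 1))) * N0 ^ (l - q) * \<Theta> ^ q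
                 * pochhammer \<kappa> q * (1 + \<Theta> * V1) powr (- (\<kappa> + real q)))"
      unfolding defs .
  next
    assume "A3 > 0"
    then have "0 \<le> tp" using \<gamma> by (simp add: \<open>tp = _\<close>)
    from gamma[OF this] show "outage_average (distr M borel (Z k)) tp N0 (gamma_law \<kappa> \<Theta>)
             = 1 - (\<Sum>i=0..m k - 1. \<Sum>l=0..i. \<Sum>q=0..l.
                 real ((m k - 1) choose i) * real (l choose q) * \<alpha> * \<delta> ^ i * exp (- V2 * N0)
                 * (tp ^ l / (fact l * A1 ^ (i - l + 1))) * N0 ^ (l - q) * \<Theta> ^ q
                 * pochhammer \<kappa> q * (1 + \<Theta> * V2) powr (- (\<kappa> + real q)))"
      unfolding defs .
  qed
qed

end
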